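(* The algebra $\Omega$ generated by the operators $\Omega_k$ for $k=1,3,5,\dots$ coincides with the algebra generated by the operators $\widetilde\Omega_k$ for $k=1,2,3,4,\dots$.
   Context: Ground field $\mathbb C$. Let $x_1,\dots,x_n$ be indeterminates, $\partial_i=x_i\frac{\partial}{\partial x_i}$. All operators are elements of the algebra of differential operators with coefficients in $\mathbb C(x_1,\dots,x_n)$; $j$ runs over $1,\dots,n$. **Operators $\Omega_k$.** $\partial_i^{(1)}=\partial_i$ and, for $k\ge2$, $$\partial_i^{(k)}=\partial_i\partial_i^{(k-1)}+\sum_{j\ne i}\frac{2x_ix_j}{x_i^2-x_j^2}\bigl(\partial_i^{(k-1)}-\partial_j^{(k-1)}\bigr)\quad(k\text{ odd}),$$ $$\partial_i^{(k)}=(\partial_i-1)\partial_i^{(k-1)}+\sum_{j\ne i}\Bigl(\frac{2x_ix_j}{x_i^2-x_j^2}\partial_i^{(k-1)}-\frac{2x_i^2}{x_i^2-x_j^2}\partial_j^{(k-1)}\Bigr)\quad(k\text{ even}).$$ For $k$ odd, $\Omega_k=\sum_{i=1}^n\partial_i^{(k)}$. **Operators $\widetilde\Omega_k$.** For $i=1,\dots,n$ set $\tilde\partial_i^{(1)}=\tilde\partial_{\bar i}^{(1)}=\partial_i$ and for $k\ge2$ $$\tilde\partial_i^{(k)}=\partial_i\tilde\partial_i^{(k-1)}+\sum_{j\ne i}\frac{x_i}{x_i-x_j}\bigl(\tilde\partial_i^{(k-1)}-\tilde\partial_j^{(k-1)}\bigr)-\sum_{j\ne i}\frac{x_i}{x_i+x_j}\bigl(\tilde\partial_i^{(k-1)}+\tilde\partial_{\bar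 j}^{(k-1)}\bigr),$$ $$\tilde\partial_{\bar i}^{(k)}=-\partial_i\tilde\partial_{\bar i}^{(k-1)}-\sum_{j\ne i}\frac{x_i}{x_i-x_j}\bigl(\tilde\partial_{\bar i}^{(k-1)}-\tilde\partial_{\bar j}^{(k-1)}\bigr)+\sum_{j\ne i}\frac{x_i}{x_i+x_j}\bigl(\tilde\partial_{\bar i}^{(k-1)}+\tilde\partial_{j}^{(k-1)}\bigr)+\bigl(\tilde\partial_{\bar i}^{(k-1)}+\tilde\partial_i^{(k-1)}\bigr).$$ For all $k\ge1$, $\widetilde\Omega_k=\sum_{i=1}^n(\tilde\partial_i^{(k)}+\tilde\partial_{\bar i}^{(k)})$. *)

theory Defs
  imports
    Complex_Main
    "HOL.Hull"
    "HOL-Library.Poly_Mapping"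
    "HOL-Computational_Algebra.Fraction_Field"
begin

section \<open>The field of rational functions and its partial derivatives\<close>

text \<open>
  The \<open>n\<close> indeterminates are indexed by the elements of a finite type \<open>'n\<close> with \<open>CARD('n) = n\<close>.
  The linear order on \<open>'n\<close> is used only by the library, to establish that polynomials form
  an integral domain.
\<close>

type_synonym 'n mpol = "('n \<Rightarrow>\<^sub>0 nat) \<Rightarrow>\<^sub>0 complex"
type_synonym 'n ratfun = "'n mpol fract"

text \<open>The monomial of exponent \<open>m\<close> in \<open>\<partial>p/\<partial>x\<^sub>i\<close> comes from the one of exponent \<open>m + e\<^sub>i\<close> in \<open>p\<close>.\<close>

lift_definition mpol_deriv :: "'n \<Rightarrow> 'n mpol \<Rightarrow> 'n mpol"
  is "\<lambda>i p m. of_nat (Suc (Poly_Mapping.lookup m i)) * p (m + Poly_Mapping.single i 1)"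
proof -
  fix i :: 'n and p :: "('n \<Rightarrow>\<^sub>0 nat) \<Rightarrow> complex"
  assume "finite {m. p m \<noteq> 0}"
  moreover have "inj (\<lambda>m :: 'n \<Rightarrow>\<^sub>0 nat. m + Poly_Mapping.single i 1)"
    by (simp add: inj_def)
  ultimately have "finite ((\<lambda>m. m + Poly_Mapping.single i 1) -` {m. p m \<noteq> 0})"
    by (intro finite_vimageI)
  then show "finite {m. of_nat (Suc (Poly_Mapping.lookup m i)) * p (m + Poly_Mapping.single i 1) \<noteq> 0}"
    by (rule rev_finite_subset) auto
qed

lemma mpol_deriv_add: "mpol_deriv i (p + q) = mpol_deriv i p + mpol_deriv i q"
  by transfer (simp add: fun_eq_iff algebra_simps)

lemma mpol_deriv_zero [simp]: "mpol_deriv i 0 = 0"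
  by transfer simp

lemma mpol_deriv_single:
  "mpol_deriv i (Poly_Mapping.single m c)
     = Poly_Mapping.single (m - Poly_Mapping.single i 1) (of_nat (Poly_Mapping.lookup m i) * c)"
proof (rule poly_mapping_eqI)
  fix k
  let ?e = "Poly_Mapping.single i (1::nat)"
  have L: "Poly_Mapping.lookup (mpol_deriv i (Poly_Mapping.single m c)) k
      = of_nat (Suc (Poly_Mapping.lookup k i)) * Poly_Mapping.lookup (Poly_Mapping.single m c) (k + ?e)"
    by (simp add: mpol_deriv.rep_eq)
  show "Poly_Mapping.lookup (mpol_deriv i (Poly_Mapping.single m c)) k
      = Poly_Mapping.lookup (Poly_Mapping.single (m - ?e) (of_nat (Poly_Mapping.lookup m i) * c)) k"
  proof (cases "m = k + ?e")
    case True
    then have "Poly_Mapping.lookup m i = Suc (Poly_Mapping.lookup k i)" by (simp add: lookup_add)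
    then show ?thesis unfolding L using True by simp
  next
    case False
    have "Poly_Mapping.lookup m i = 0 \<or> m - ?e \<noteq> k"
    proof (rule ccontr)
      assume "\<not> ?thesis"
      then have "Poly_Mapping.lookup m i \<noteq> 0" "m - ?e = k" by auto
      then have "m = k + ?e"
        by (auto intro!: poly_mapping_eqI simp: lookup_add lookup_minus lookup_single when_def)
      with False show False by simp
    qed
    then show ?thesis unfolding L using False
      by (auto simp: lookup_single when_def)
  qed
qed

lemma mpol_deriv_one: "mpol_deriv i 1 = 0"
  using mpol_deriv_single[of i 0 1] by simp

lemma mpol_induct [case_names zero add_single]:
  fixes p :: "'n mpol"
  assumes "P 0" and "\<And>m c p. P p \<Longrightarrow> P (Poly_Mapping.single m c + p)"
  shows "P p"
proof (induction p rule: update_induct)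
  case const
  show ?case by (simp add: \<open>P 0\<close>)
next
  case (update p m c)
  have "Poly_Mapping.update m c p = Poly_Mapping.single m c + p"
    using update(1)
    by (auto intro!: poly_mapping_eqI
        simp: lookup_update lookup_add lookup_single when_def in_keys_iff)
  then show ?case using assms(2) update by metis
qed

lemma mpol_deriv_mult: "mpol_deriv i (p * q) = mpol_deriv i p * q + p * mpol_deriv i q"
proof (induction p rule: mpol_induct)
  case zero
  show ?case by simp
next
  case (add_single m c p)
  have "mpol_deriv i (Poly_Mapping.single m c * q)
      = mpol_deriv i (Poly_Mapping.single m c) * q + Poly_Mapping.single m c * mpol_deriv i q"
  proof (induction q rule: mpol_induct)
    case zero
    show ?case by simp
  next
    case (add_single m' c' q)
    let ?e = "Poly_Mapping.single i (1::nat)"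
    have 1: "m - ?e + m' = m + m' - ?e" if "Poly_Mapping.lookup m i > 0"
      using that by (auto intro!: poly_mapping_eqI
          simp: lookup_add lookup_minus lookup_single when_def)
    have 2: "m + (m' - ?e) = m + m' - ?e" if "Poly_Mapping.lookup m' i > 0"
      using that by (auto intro!: poly_mapping_eqI
          simp: lookup_add lookup_minus lookup_single when_def)
    have "mpol_deriv i (Poly_Mapping.single m c * Poly_Mapping.single m' c')
      = mpol_deriv i (Poly_Mapping.single m c) * Poly_Mapping.single m' c'
        + Poly_Mapping.single m c * mpol_deriv i (Poly_Mapping.single m' c')"
      using 1 2
      by (cases "Poly_Mapping.lookup m i = 0"; cases "Poly_Mapping.lookup m' i = 0")
         (simp_all add: mpol_deriv_single mult_single lookup_add algebra_simps
           flip: single_add)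
    then show ?case using add_single by (simp add: mpol_deriv_add algebra_simps)
  qed
  then show ?case using add_single by (simp add: mpol_deriv_add algebra_simps)
qed

lift_definition rf_deriv :: "'n::{finite,linorder} \<Rightarrow> 'n ratfun \<Rightarrow> 'n ratfun"
  is "\<lambda>i (p, q). (mpol_deriv i p * q - p * mpol_deriv i q, q\<^sup>2)"
proof -
  fix i :: 'n and x y :: "'n mpol \<times> 'n mpol"
  assume rel: "fractrel x y"
  obtain p q r s where x: "x = (p, q)" and y: "y = (r, s)" by (cases x, cases y)
  have nz: "q \<noteq> 0" "s \<noteq> 0" and eq: "p * s = r * q" using rel by (auto simp: x y)
  let ?d = "mpol_deriv i"
  have "?d p * s + p * ?d s = ?d r * q + r * ?d q"
    using arg_cong[OF eq, of ?d] by (simp add: mpol_deriv_mult)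
  then have "(?d p * s + p * ?d s) * (q * s) = (?d r * q + r * ?d q) * (q * s)"
    by simp
  then have "(?d p * q - p * ?d q) * s\<^sup>2 = (?d r * s - r * ?d s) * q\<^sup>2"
    using eq by algebra
  then show "fractrel (case x of (p, q) \<Rightarrow> (?d p * q - p * ?d q, q\<^sup>2))
     (case y of (p, q) \<Rightarrow> (?d p * q - p * ?d q, q\<^sup>2))"
    using nz by (simp add: x y)
qed

lemma rf_deriv_Fract:
  "q \<noteq> 0 \<Longrightarrow> rf_deriv i (Fract p q) = Fract (mpol_deriv i p * q - p * mpol_deriv i q) (q\<^sup>2)"
  by transfer simp

definition rf_const :: "complex \<Rightarrow> 'n::{finite,linorder} ratfun"
  where "rf_const c = Fract (Poly_Mapping.single 0 c) 1"

definition rf_var :: "'n::{finite,linorder} \<Rightarrow> 'n ratfun"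
  where "rf_var i = Fract (Poly_Mapping.single (Poly_Mapping.single i 1) 1) 1"

lemma rf_deriv_var: "rf_deriv i (rf_var j) = (if i = j then 1 else 0)"
  by (simp add: rf_var_def rf_deriv_Fract mpol_deriv_one mpol_deriv_single lookup_single
      One_fract_def Zero_fract_def)

section \<open>Differential operators and generated algebras\<close>

text \<open>
  A differential operator is represented by its action on the field of rational functions
  (this action is faithful). Multiplication of operators is composition, and
  a rational function \<open>g\<close> is the operator of multiplication by \<open>g\<close>.
\<close>

type_synonym 'n rf_op = "'n ratfun \<Rightarrow> 'n ratfun"

text \<open>Subalgebras are unital and over \<open>\<complex>\<close>. The scalars \<open>0\<close> and \<open>-1\<close> give the zero operator and negation.\<close>

definition op_subalgebra :: "'n::{finite,linorder} rf_op set \<Rightarrow> bool"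
  where "op_subalgebra A \<longleftrightarrow>
    id \<in> A \<and>
    (\<forall>P\<in>A. \<forall>Q\<in>A. (\<lambda>f. P f + Q f) \<in> A) \<and>
    (\<forall>c. \<forall>P\<in>A. (\<lambda>f. rf_const c * P f) \<in> A) \<and>
    (\<forall>P\<in>A. \<forall>Q\<in>A. P \<circ> Q \<in> A)"

definition generated_algebra :: "'n::{finite,linorder} rf_op set \<Rightarrow> 'n rf_op set"
  where "generated_algebra S = op_subalgebra hull S"

lemma op_subalgebra_generated: "op_subalgebra (generated_algebra S)"
  unfolding generated_algebra_def by (rule hull_in) (simp add: op_subalgebra_def Ball_def)

definition diff_ops :: "'n::{finite,linorder} rf_op set"
  where "diff_ops = generated_algebra (range (*) \<union> range rf_deriv)"

section \<open>The two families of operators\<close>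

definition euler :: "'n::{finite,linorder} \<Rightarrow> 'n rf_op"
  where "euler i f = rf_var i * rf_deriv i f"

text \<open>
  In all the recursions below the operators start at \<open>k = 1\<close>; the value at \<open>k = 0\<close> is a
  dummy which is never used.
\<close>

fun dunkl :: "nat \<Rightarrow> 'n::{finite,linorder} \<Rightarrow> 'n rf_op"
  where
    "dunkl 0 i f = 0"
  | "dunkl (Suc 0) i f = euler i f"
  | "dunkl (Suc (Suc k)) i f =
      (if odd k
       then euler i (dunkl (Suc k) i f)
         + (\<Sum>j\<in>UNIV - {i}. 2 * rf_var i * rf_var j / ((rf_var i)\<^sup>2 - (rf_var j)\<^sup>2)
              * (dunkl (Suc k) i f - dunkl (Suc k) j f))
       else (euler i (dunkl (Suc k) i f) - dunkl (Suc k) i f)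
         + (\<Sum>j\<in>UNIV - {i}.
              2 * rf_var i * rf_var j / ((rf_var i)\<^sup>2 - (rf_var j)\<^sup>2) * dunkl (Suc k) i f
              - 2 * (rf_var i)\<^sup>2 / ((rf_var i)\<^sup>2 - (rf_var j)\<^sup>2) * dunkl (Suc k) j f))"

definition Omega :: "nat \<Rightarrow> 'n::{finite,linorder} rf_op"
  where "Omega k f = (\<Sum>i\<in>UNIV. dunkl k i f)"

fun dunkl_t :: "nat \<Rightarrow> 'n::{finite,linorder} \<Rightarrow> 'n rf_op"
  and dunkl_tbar :: "nat \<Rightarrow> 'n \<Rightarrow> 'n rf_op"
  where
    "dunkl_t 0 i f = 0"
  | "dunkl_t (Suc 0) i f = euler i f"
  | "dunkl_t (Suc (Suc k)) i f =
      euler i (dunkl_t (Suc k) i f)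
      + (\<Sum>j\<in>UNIV - {i}. rf_var i / (rf_var i - rf_var j)
           * (dunkl_t (Suc k) i f - dunkl_t (Suc k) j f))
      - (\<Sum>j\<in>UNIV - {i}. rf_var i / (rf_var i + rf_var j)
           * (dunkl_t (Suc k) i f + dunkl_tbar (Suc k) j f))"
  | "dunkl_tbar 0 i f = 0"
  | "dunkl_tbar (Suc 0) i f = euler i f"
  | "dunkl_tbar (Suc (Suc k)) i f =
      - euler i (dunkl_tbar (Suc k) i f)
      - (\<Sum>j\<in>UNIV - {i}. rf_var i / (rf_var i - rf_var j)
           * (dunkl_tbar (Suc k) i f - dunkl_tbar (Suc k) j f))
      + (\<Sum>j\<in>UNIV - {i}. rf_var i / (rf_var i + rf_var j)
           * (dunkl_tbar (Suc k) i f + dunkl_t (Suc k) j f))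
      + (dunkl_tbar (Suc k) i f + dunkl_t (Suc k) i f)"

definition Omega_t :: "nat \<Rightarrow> 'n::{finite,linorder} rf_op"
  where "Omega_t k f = (\<Sum>i\<in>UNIV. dunkl_t k i f + dunkl_tbar k i f)"

section \<open>All these operators are differential operators\<close>

lemma diff_ops_mult: "(*) g \<in> diff_ops"
  unfolding diff_ops_def generated_algebra_def by (rule hull_inc) simp

lemma diff_ops_deriv: "rf_deriv i \<in> diff_ops"
  unfolding diff_ops_def generated_algebra_def by (rule hull_inc) simp

lemma
  assumes "P \<in> diff_ops" and "Q \<in> diff_ops"
  shows diff_ops_add: "(\<lambda>f. P f + Q f) \<in> diff_ops"
    and diff_ops_comp: "(\<lambda>f. P (Q f)) \<in> diff_ops"
  using op_subalgebra_generated[of "range (*) \<union> range rf_deriv"] assms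
  unfolding op_subalgebra_def diff_ops_def comp_def by blast+

lemma diff_ops_scale: "P \<in> diff_ops \<Longrightarrow> (\<lambda>f. g * P f) \<in> diff_ops"
  using diff_ops_comp[OF diff_ops_mult] .

lemma diff_ops_zero: "(\<lambda>f. 0) \<in> diff_ops"
  using diff_ops_scale[OF diff_ops_mult[of 1], of 0] by simp

lemma diff_ops_minus: "P \<in> diff_ops \<Longrightarrow> (\<lambda>f. - P f) \<in> diff_ops"
  using diff_ops_scale[of P "- 1"] by simp

lemma diff_ops_diff:
  "P \<in> diff_ops \<Longrightarrow> Q \<in> diff_ops \<Longrightarrow> (\<lambda>f. P f - Q f) \<in> diff_ops"
  using diff_ops_add[OF _ diff_ops_minus, of P Q] by simp

lemma diff_ops_sum:
  assumes "\<And>j. j \<in> J \<Longrightarrow> P j \<in> diff_ops"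
  shows "(\<lambda>f. \<Sum>j\<in>J. P j f) \<in> diff_ops"
  using assms
  by (induction J rule: infinite_finite_induct) (auto simp: diff_ops_zero intro: diff_ops_add)

lemma diff_ops_euler: "P \<in> diff_ops \<Longrightarrow> (\<lambda>f. euler i (P f)) \<in> diff_ops"
  unfolding euler_def by (intro diff_ops_scale diff_ops_comp[OF diff_ops_deriv])

lemma diff_ops_euler': "euler i \<in> diff_ops"
  unfolding euler_def[abs_def] by (intro diff_ops_scale diff_ops_deriv)

lemmas diff_ops_intros = diff_ops_add diff_ops_diff diff_ops_minus diff_ops_sum
  diff_ops_scale diff_ops_euler diff_ops_zero

lemma dunkl_diff_ops:
  fixes i :: "'n::{finite,linorder}"
  shows "(\<lambda>f. dunkl k i f) \<in> diff_ops"
proof (induction k arbitrary: i rule: less_induct)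
  case (less k)
  consider "k = 0" | "k = Suc 0" | l where "k = Suc (Suc l)"
    by (metis not0_implies_Suc)
  then show ?case
  proof cases
    case (3 l)
    have IH: "(\<lambda>f. dunkl (Suc l) j f) \<in> diff_ops" for j :: 'n
      using less[of "Suc l" j] 3 by simp
    show ?thesis
      unfolding 3 dunkl.simps
      by (cases "odd l"; simp only: if_True if_False simp_thms)
         (intro diff_ops_intros IH)+
  qed (simp_all add: diff_ops_zero diff_ops_euler')
qed

lemma dunkl_t_diff_ops:
  fixes i :: "'n::{finite,linorder}"
  shows "(\<lambda>f. dunkl_t k i f) \<in> diff_ops \<and> (\<lambda>f. dunkl_tbar k i f) \<in> diff_ops"
proof (induction k arbitrary: i rule: less_induct)
  case (less k)
  consider "k = 0" | "k = Suc 0" | l where "k = Suc (Suc l)"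
    by (metis not0_implies_Suc)
  then show ?case
  proof cases
    case (3 l)
    have IH: "(\<lambda>f. dunkl_t (Suc l) j f) \<in> diff_ops"
        "(\<lambda>f. dunkl_tbar (Suc l) j f) \<in> diff_ops" for j :: 'n
      using less[of "Suc l" j] 3 by simp_all
    show ?thesis
      unfolding 3 dunkl_t.simps dunkl_tbar.simps
      by (intro conjI diff_ops_intros IH)
  qed (simp_all add: diff_ops_zero diff_ops_euler')
qed

lemma Omega_diff_ops: "Omega k \<in> diff_ops"
  unfolding Omega_def[abs_def] by (intro diff_ops_intros dunkl_diff_ops)

lemma Omega_t_diff_ops: "Omega_t k \<in> diff_ops"
  unfolding Omega_t_def[abs_def] by (intro diff_ops_intros dunkl_t_diff_ops[THEN conjunct1]
      dunkl_t_diff_ops[THEN conjunct2])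

end

theory Submission
  imports Defs
begin

text \<open>
  For each order let \<open>a\<close> and \<open>b\<close> be the vectors of sums and differences of the tilde operators with
  index \<open>i\<close> and \<open>i\<close> barred. If \<open>S\<close> and \<open>T\<close> denote the steps to an odd and to an even order in the
  recursion of the \<open>\<Omega>\<close> family, then the recursion of the tilde family becomes \<open>a' = a + S b\<close> and
  \<open>b' = T a\<close>. Hence \<open>a'' = a' + S (T a)\<close>, a Fibonacci recursion. As \<open>S \<circ> T\<close> raises odd orders of the
  \<open>\<Omega>\<close> family by two, the tilde family is obtained from it by the Fibonacci polynomials,
  whose coefficients are \<open>(k - m) choose m\<close>. This system is triangular with diagonal
  entries 2, hence invertible.
\<close>

text \<open>These give nonzero denominators in the recursions. Differentiation in direction
  \<open>i\<close> separates the two indeterminates; a nonzero coefficient shows that their sum is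
  not 0.\<close>

lemma rf_var_neq:
  assumes "i \<noteq> j"
  shows "rf_var i \<noteq> rf_var j" "rf_var i + rf_var j \<noteq> 0"
proof -
  have "rf_deriv i (rf_var i) \<noteq> rf_deriv i (rf_var j)"
    using assms by (simp add: rf_deriv_var)
  then show "rf_var i \<noteq> rf_var j" by metis
  let ?v = "\<lambda>i :: 'a. Poly_Mapping.single (Poly_Mapping.single i (1::nat)) (1::complex)"
  have "Poly_Mapping.single i (1::nat) \<noteq> Poly_Mapping.single j 1"
    using assms by (metis lookup_single_eq lookup_single_not_eq one_neq_zero)
  then have "Poly_Mapping.lookup (?v i + ?v j) (Poly_Mapping.single i 1) \<noteq> 0"
    by (simp add: lookup_add lookup_single)
  then have "?v i + ?v j \<noteq> 0"
    by (metis lookup_zero)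
  then show "rf_var i + rf_var j \<noteq> 0"
    by (simp add: rf_var_def Zero_fract_def eq_fract)
qed

lemma rf_deriv_add: "rf_deriv i (f + g) = rf_deriv i f + rf_deriv i g"
proof (cases f; cases g)
  fix p q r s :: "'a mpol"
  assume *: "f = Fract p q" "q \<noteq> 0" "g = Fract r s" "s \<noteq> 0"
  then show ?thesis
    by (simp add: rf_deriv_Fract eq_fract mpol_deriv_add mpol_deriv_mult)
       (simp add: algebra_simps power2_eq_square)
qed

lemma euler_add: "euler i (f + g) = euler i f + euler i g"
  by (simp add: euler_def rf_deriv_add algebra_simps)

lemma euler_zero [simp]: "euler i 0 = 0"
  using euler_add[of i 0 0] by (metis add_0 add_cancel_right_right)

lemma euler_diff: "euler i (f - g) = euler i f - euler i g"
  using euler_add[of i "f - g" g] by simp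

lemma euler_of_nat_mult: "euler i (of_nat c * f) = of_nat c * euler i f"
  by (induction c) (simp_all add: euler_add algebra_simps)

lemma euler_sum: "euler i (\<Sum>m\<in>M. g m) = (\<Sum>m\<in>M. euler i (g m))"
  by (induction M rule: infinite_finite_induct) (simp_all add: euler_add)

lemma rf_const_add: "rf_const (a + b) = rf_const a + rf_const b"
  by (simp add: rf_const_def single_add)

lemma rf_const_mult: "rf_const (a * b) = rf_const a * rf_const b"
  by (simp add: rf_const_def mult_single)

lemma rf_const_0 [simp]: "rf_const 0 = 0"
  by (simp add: rf_const_def Zero_fract_def)

lemma rf_const_1 [simp]: "rf_const 1 = 1"
  by (simp add: rf_const_def One_fract_def)

lemma rf_const_of_nat: "rf_const (of_nat c) = of_nat c"
  by (induction c) (simp_all add: rf_const_add)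

lemma rf_const_numeral: "rf_const (numeral w) = numeral w"
  by (metis rf_const_of_nat of_nat_numeral)

text \<open>This is \<open>S\<close>, and \<open>even_step\<close> is \<open>T\<close>. They act on
  families of rational functions, since the recursions involve lower operators only through their
  values at a fixed \<open>f\<close>.\<close>

definition odd_step :: "('n::{finite,linorder} \<Rightarrow> 'n ratfun) \<Rightarrow> 'n \<Rightarrow> 'n ratfun"
  where "odd_step b i = euler i (b i)
    + (\<Sum>j\<in>UNIV - {i}. 2 * rf_var i * rf_var j / ((rf_var i)\<^sup>2 - (rf_var j)\<^sup>2) * (b i - b j))"

definition even_step :: "('n::{finite,linorder} \<Rightarrow> 'n ratfun) \<Rightarrow> 'n \<Rightarrow> 'n ratfun"
  where "even_step a i = (euler i (a i) - a i)
    + (\<Sum>j\<in>UNIV - {i}. 2 * rf_var i * rf_var j / ((rf_var i)\<^sup>2 - (rf_var j)\<^sup>2) * a i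
         - 2 * (rf_var i)\<^sup>2 / ((rf_var i)\<^sup>2 - (rf_var j)\<^sup>2) * a j)"

text \<open>Writing the even order as \<open>2 * Suc m\<close> keeps the dummy order 0 out.\<close>

lemma dunkl_odd: "dunkl (Suc (2 * Suc m)) i f = odd_step (\<lambda>i. dunkl (2 * Suc m) i f) i"
  by (simp add: odd_step_def)

lemma dunkl_even: "dunkl (2 * Suc m) i f = even_step (\<lambda>i. dunkl (Suc (2 * m)) i f) i"
  by (simp add: even_step_def)

text \<open>Natural coefficients suffice for the binomials to come, and \<open>euler\<close>
  commutes with them by additivity alone.\<close>

lemma odd_step_sum:
  "odd_step (\<lambda>i. \<Sum>m\<in>M. of_nat (c m) * g m i) i = (\<Sum>m\<in>M. of_nat (c m) * odd_step (g m) i)"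
  unfolding odd_step_def euler_sum euler_of_nat_mult distrib_left sum.distrib sum_distrib_left
    sum_subtractf[symmetric]
  by (subst (2) sum.swap) (simp add: algebra_simps)

lemma even_step_sum:
  "even_step (\<lambda>i. \<Sum>m\<in>M. of_nat (c m) * g m i) i = (\<Sum>m\<in>M. of_nat (c m) * even_step (g m) i)"
  unfolding even_step_def euler_sum euler_of_nat_mult distrib_left sum.distrib sum_distrib_left
    sum_subtractf[symmetric]
  by (subst (2) sum.swap) (simp add: algebra_simps sum_subtractf)

text \<open>Partial fractions: the coefficients in \<open>odd_step\<close> and
  \<open>even_step\<close> are the difference and the sum of those in the tilde recursion.\<close>

lemma frac_combine:
  fixes x y :: "'a::field"
  assumes "x \<noteq> y" "x + y \<noteq> 0"
  shows "x / (x - y) - x / (x + y) = 2 * x * y / (x\<^sup>2 - y\<^sup>2)"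
    and "x / (x - y) + x / (x + y) = 2 * x\<^sup>2 / (x\<^sup>2 - y\<^sup>2)"
proof -
  have "x - y \<noteq> 0" and [simp]: "x\<^sup>2 - y\<^sup>2 = (x - y) * (x + y)"
    using assms by (simp_all add: algebra_simps power2_eq_square)
  then show "x / (x - y) - x / (x + y) = 2 * x * y / (x\<^sup>2 - y\<^sup>2)"
    and "x / (x - y) + x / (x + y) = 2 * x\<^sup>2 / (x\<^sup>2 - y\<^sup>2)"
    using assms by (simp_all add: diff_frac_eq add_frac_eq algebra_simps power2_eq_square)
qed

text \<open>The opposite signs in the two recursions leave only differences inside
  \<open>odd_step\<close>; the last summand of the barred recursion supplies the separate
  sum.\<close>

lemma dunkl_t_plus_tbar_step:
  "dunkl_t (Suc (Suc k)) i f + dunkl_tbar (Suc (Suc k)) i f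
    = dunkl_t (Suc k) i f + dunkl_tbar (Suc k) i f
      + odd_step (\<lambda>i. dunkl_t (Suc k) i f - dunkl_tbar (Suc k) i f) i"
proof -
  let ?x = rf_var and ?u = "\<lambda>i. dunkl_t (Suc k) i f" and ?v = "\<lambda>i. dunkl_tbar (Suc k) i f"
  have "2 * ?x i * ?x j / ((?x i)\<^sup>2 - (?x j)\<^sup>2) * ((?u i - ?v i) - (?u j - ?v j))
      = ?x i / (?x i - ?x j) * (?u i - ?u j) - ?x i / (?x i + ?x j) * (?u i + ?v j)
        - ?x i / (?x i - ?x j) * (?v i - ?v j) + ?x i / (?x i + ?x j) * (?v i + ?u j)"
    if "j \<in> UNIV - {i}" for j
  proof -
    from that have "i \<noteq> j" by simp
    note * = rf_var_neq[OF this]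
    show ?thesis
      unfolding frac_combine(1)[OF *, symmetric] by (simp only: algebra_simps)
  qed
  then show ?thesis
    unfolding odd_step_def dunkl_t.simps(3) dunkl_tbar.simps(3)
    by (simp add: sum.distrib sum_subtractf euler_diff)
qed

text \<open>Here the last summand of the barred recursion enters negatively and becomes the
  \<open>- a i\<close> of \<open>even_step\<close>.\<close>

lemma dunkl_t_minus_tbar_step:
  "dunkl_t (Suc (Suc k)) i f - dunkl_tbar (Suc (Suc k)) i f
    = even_step (\<lambda>i. dunkl_t (Suc k) i f + dunkl_tbar (Suc k) i f) i"
proof -
  let ?x = rf_var and ?u = "\<lambda>i. dunkl_t (Suc k) i f" and ?v = "\<lambda>i. dunkl_tbar (Suc k) i f"
  have "2 * ?x i * ?x j / ((?x i)\<^sup>2 - (?x j)\<^sup>2) * (?u i + ?v i)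
        - 2 * (?x i)\<^sup>2 / ((?x i)\<^sup>2 - (?x j)\<^sup>2) * (?u j + ?v j)
      = ?x i / (?x i - ?x j) * (?u i - ?u j) - ?x i / (?x i + ?x j) * (?u i + ?v j)
        + ?x i / (?x i - ?x j) * (?v i - ?v j) - ?x i / (?x i + ?x j) * (?v i + ?u j)"
    if "j \<in> UNIV - {i}" for j
  proof -
    from that have "i \<noteq> j" by simp
    note * = rf_var_neq[OF this]
    show ?thesis
      unfolding frac_combine[OF *, symmetric] by (simp only: algebra_simps)
  qed
  then show ?thesis
    unfolding even_step_def dunkl_t.simps(3) dunkl_tbar.simps(3)
    by (simp add: sum.distrib sum_subtractf euler_add)
qed

text \<open>Pascal's rule turns these sums into a Fibonacci recursion. Terms with \<open>m\<close>
  above half of the upper bound vanish, so the ranges need no halving.\<close>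

lemma sum_choose_Suc_Suc:
  fixes d :: "nat \<Rightarrow> 'a::comm_semiring_1"
  shows "(\<Sum>m\<le>Suc (Suc k). of_nat ((Suc (Suc k) - m) choose m) * d m)
    = (\<Sum>m\<le>Suc k. of_nat ((Suc k - m) choose m) * d m)
      + (\<Sum>m\<le>k. of_nat ((k - m) choose m) * d (Suc m))"
proof -
  have "of_nat ((Suc k - m) choose Suc m) * d (Suc m)
      = of_nat ((k - m) choose Suc m) * d (Suc m) + of_nat ((k - m) choose m) * d (Suc m)"
    if "m \<in> {..k}" for m
    using that by (simp add: Suc_diff_le algebra_simps)
  then show ?thesis
    by (subst (1 2) sum.atMost_Suc_shift) (simp add: sum.distrib add.assoc)
qed

lemma dunkl_t_plus_tbar:
  "dunkl_t (Suc k) i f + dunkl_tbar (Suc k) i f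
    = (\<Sum>m\<le>k. of_nat (2 * ((k - m) choose m)) * dunkl (Suc (2 * m)) i f)"
proof (induction k arbitrary: i rule: less_induct)
  case (less k)
  consider "k = 0" | "k = 1" | l where "k = Suc (Suc l)"
    by (metis One_nat_def not0_implies_Suc)
  then show ?case
  proof cases
    case 1
    then show ?thesis by simp
  next
    \<comment> \<open>The second initial value: both tilde operators of order 1 are
      \<open>euler i\<close>, so their difference, and with it the \<open>odd_step\<close> term, is
      0.\<close>
    case 2
    then show ?thesis
      by (simp del: dunkl_t.simps(3) dunkl_tbar.simps(3)
          add: dunkl_t_plus_tbar_step) (simp add: odd_step_def)
  next
    case (3 l)
    let ?e = "\<lambda>m i. dunkl (Suc (2 * m)) i f"
    have "dunkl_t (Suc k) i f + dunkl_tbar (Suc k) i f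
        = (\<Sum>m\<le>Suc l. of_nat (2 * ((Suc l - m) choose m)) * ?e m i)
          + odd_step (even_step (\<lambda>i. \<Sum>m\<le>l. of_nat (2 * ((l - m) choose m)) * ?e m i)) i"
      unfolding 3 dunkl_t_plus_tbar_step[of "Suc l"] dunkl_t_minus_tbar_step
      using less[of l] less[of "Suc l"] 3 by (simp del: dunkl_t.simps dunkl_tbar.simps dunkl.simps)
    \<comment> \<open>By linearity both steps reach the individual \<open>?e m\<close>, where
      together they raise the order by two.\<close>
    also have "odd_step (even_step (\<lambda>i. \<Sum>m\<le>l. of_nat (2 * ((l - m) choose m)) * ?e m i)) i
        = (\<Sum>m\<le>l. of_nat (2 * ((l - m) choose m)) * ?e (Suc m) i)"
      unfolding even_step_sum odd_step_sum dunkl_odd dunkl_even ..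
    finally show ?thesis
      unfolding 3 using sum_choose_Suc_Suc[of l "\<lambda>m. 2 * ?e m i"]
      by (simp del: dunkl.simps sum.atMost_Suc add: mult_ac)
  qed
qed

lemma Omega_t_Suc:
  "Omega_t (Suc k) f = (\<Sum>m\<le>k. of_nat (2 * ((k - m) choose m)) * Omega (Suc (2 * m)) f)"
  unfolding Omega_t_def Omega_def dunkl_t_plus_tbar sum_distrib_left by (rule sum.swap)

text \<open>The triangular form: the binomial is 0 for \<open>m > n\<close> and 1 for
  \<open>m = n\<close>.\<close>

lemma Omega_t_odd:
  "Omega_t (Suc (2 * n)) f
    = 2 * Omega (Suc (2 * n)) f
      + (\<Sum>m<n. of_nat (2 * ((2 * n - m) choose m)) * Omega (Suc (2 * m)) f)"
proof -
  have "Omega_t (Suc (2 * n)) f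
      = (\<Sum>m\<le>n. of_nat (2 * ((2 * n - m) choose m)) * Omega (Suc (2 * m)) f)"
    unfolding Omega_t_Suc by (rule sum.mono_neutral_right) (auto simp: binomial_eq_0)
  then show ?thesis
    by (simp add: lessThan_Suc_atMost[symmetric] add.commute)
qed

lemma
  assumes "op_subalgebra A" and "P \<in> A"
  shows op_subalgebra_add: "Q \<in> A \<Longrightarrow> (\<lambda>f. P f + Q f) \<in> A"
    and op_subalgebra_scale: "(\<lambda>f. rf_const c * P f) \<in> A"
  using assms unfolding op_subalgebra_def by simp_all

lemma op_subalgebra_zero: "op_subalgebra A \<Longrightarrow> (\<lambda>f. 0) \<in> A"
  using op_subalgebra_scale[of A id 0] by (simp add: op_subalgebra_def)

lemma op_subalgebra_sum:
  assumes A: "op_subalgebra A" and P: "\<And>m. m \<in> M \<Longrightarrow> P m \<in> A"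
  shows "(\<lambda>f. \<Sum>m\<in>M. of_nat (c m) * P m f) \<in> A"
  using P
proof (induction M rule: infinite_finite_induct)
  case (insert m M)
  then show ?case
    using op_subalgebra_add[OF A] op_subalgebra_scale[OF A, of "P m" "of_nat (c m)"]
    by (simp add: rf_const_of_nat)
qed (simp_all add: op_subalgebra_zero[OF A])

lemma generated_algebra_least:
  "S \<subseteq> A \<Longrightarrow> op_subalgebra A \<Longrightarrow> generated_algebra S \<subseteq> A"
  unfolding generated_algebra_def by (rule hull_minimal)

lemma generated_algebra_base: "P \<in> S \<Longrightarrow> P \<in> generated_algebra S"
  unfolding generated_algebra_def by (rule hull_inc)

lemma Omega_odd_mem:
  assumes A: "op_subalgebra A" and T: "\<And>k. Omega_t (Suc k) \<in> A"
  shows "Omega (Suc (2 * n)) \<in> A"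
proof (induction n rule: less_induct)
  case (less n)
  let ?R = "\<lambda>f. \<Sum>m<n. of_nat (2 * ((2 * n - m) choose m)) * Omega (Suc (2 * m)) f"
  have "?R \<in> A"
    using less by (intro op_subalgebra_sum A) auto
  \<comment> \<open>Solves the triangular relation for its diagonal term, using only sums and
    complex scalars.\<close>
  then have "(\<lambda>f. rf_const (1/2) * (Omega_t (Suc (2 * n)) f + rf_const (-1) * ?R f)) \<in> A"
    by (intro op_subalgebra_scale op_subalgebra_add A T)
  moreover have "rf_const (-1) = (-1 :: 'a ratfun)"
    by (simp add: eq_neg_iff_add_eq_0 flip: rf_const_add rf_const_1)
  moreover have "rf_const (1/2) * (2 * g) = g" for g :: "'a ratfun"
  proof -
    have "rf_const (1/2) * (2 * g) = rf_const (1/2 * 2) * g"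
      by (simp only: rf_const_mult rf_const_numeral mult.assoc)
    also have "\<dots> = g"
      by simp
    finally show ?thesis .
  qed
  ultimately show ?case
    by (simp add: Omega_t_odd)
qed

theorem lemma1p2p1:
  "generated_algebra {Omega k | k. odd k}
     = generated_algebra {Omega_t k :: 'n::{finite,linorder} rf_op | k. 1 \<le> k}"
proof (rule antisym; rule generated_algebra_least)
  let ?A = "generated_algebra {Omega k :: 'n rf_op | k. odd k}"
  let ?B = "generated_algebra {Omega_t k :: 'n rf_op | k. 1 \<le> k}"
  show A: "op_subalgebra ?A" and B: "op_subalgebra ?B"
    by (rule op_subalgebra_generated)+
  have "Omega_t (Suc k) \<in> ?B" for k
    by (rule generated_algebra_base) auto
  then show "{Omega k | k. odd k} \<subseteq> ?B"
    using Omega_odd_mem[OF B] by (auto elim!: oddE)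
  \<comment> \<open>The closed form involves only odd orders \<open>Suc (2 * m)\<close>, also when
    \<open>Suc k\<close> is even.\<close>
  have "Omega_t (Suc k) \<in> ?A" for k
    unfolding Omega_t_Suc[abs_def]
    by (rule op_subalgebra_sum[OF A], rule generated_algebra_base) auto
  then show "{Omega_t k | k. 1 \<le> k} \<subseteq> ?A"
    by (auto simp: Suc_le_eq dest!: gr0_implies_Suc)
qed

end
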